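(* Let $G$ be a finite nonempty simple graph with $n$ vertices. For each vertex $u\in V(G)$, let $G_u=G\setminus\{u\}$ be the induced subgraph of $G$ on $V(G)\setminus\{u\}$. Then $$s(G)\leq\min_{u\in V(G)}\{n-1+\sigma(G_u)\}.$$
   Context: Nonempty means having at least one edge. A vertex labeling of a graph $G$ is an injective map $f:V(G)\to\mathbb{Z}$. It induces the edge labeling $f^+:E(G)\to\mathbb{Z}$, $f^+(uv)=f(u)+f(v)$, and $|f^+|$ denotes the number of distinct values $f^+$ takes on $E(G)$. The sum index $s(G)$ is the minimum positive integer $k$ such that there exists a vertex labeling $f$ of $G$ with $|f^+|=k$. Let $\mathbb{N}$ denote the set of positive integers. A sum labeling of a graph $H$ is an injective map $f:V(H)\to\mathbb{N}$ such that two (distinct) vertices $v,w\in V(H)$ are adjacent if and only if $f(v)+f(w)=f(x)$ for some vertex $x\in V(H)$. A graph admitting a sum labeling is called a sum graph. $\overline{K_k}$ denotes the graph of $k$ isolated vertices. The sum number $\sigma(H)$ is the minimum nonnegative integer $k$ such that the disjoint union $H\cup\overline{K_k}$ is a sum graph. *)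

theory Defs
  imports "Graph_Theory.Digraph_Component"
begin

text \<open>
  A finite simple undirected graph is an instance of the library locale \<^locale>\<open>graph\<close>: a finite
  symmetric digraph without loops and without parallel arcs. The edge \<open>uv\<close> is the pair of arcs
  from \<open>u\<close> to \<open>v\<close> and from \<open>v\<close> to \<open>u\<close>.
\<close>

definition vertex_labeling :: "('a, 'b) pre_digraph \<Rightarrow> ('a \<Rightarrow> int) \<Rightarrow> bool" where
  "vertex_labeling G f \<longleftrightarrow> inj_on f (verts G)"

text \<open>The two arcs of an edge get the same label, so this is a labeling of the edges.\<close>

definition edge_labeling :: "('a, 'b) pre_digraph \<Rightarrow> ('a \<Rightarrow> int) \<Rightarrow> 'b \<Rightarrow> int" where
  "edge_labeling G f e = f (tail G e) + f (head G e)"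

definition sum_index :: "('a, 'b) pre_digraph \<Rightarrow> nat" where
  "sum_index G =
     (LEAST k. 0 < k \<and> (\<exists>f. vertex_labeling G f \<and> card (edge_labeling G f ` arcs G) = k))"

definition sum_labeling :: "('a, 'b) pre_digraph \<Rightarrow> ('a \<Rightarrow> nat) \<Rightarrow> bool" where
  "sum_labeling H f \<longleftrightarrow>
     inj_on f (verts H) \<and>
     (\<forall>v\<in>verts H. 0 < f v) \<and>
     (\<forall>v\<in>verts H. \<forall>w\<in>verts H. v \<noteq> w \<longrightarrow>
        (v \<rightarrow>\<^bsub>H\<^esub> w \<longleftrightarrow> (\<exists>x\<in>verts H. f v + f w = f x)))"

definition sum_graph :: "('a, 'b) pre_digraph \<Rightarrow> bool" where
  "sum_graph H \<longleftrightarrow> (\<exists>f. sum_labeling H f)"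

definition disjoint_union ::
  "('a, 'b) pre_digraph \<Rightarrow> ('c, 'd) pre_digraph \<Rightarrow> ('a + 'c, 'b + 'd) pre_digraph" where
  "disjoint_union G H =
     \<lparr> verts = verts G <+> verts H,
       arcs = arcs G <+> arcs H,
       tail = map_sum (tail G) (tail H),
       head = map_sum (head G) (head H) \<rparr>"

text \<open>\<open>k\<close> isolated vertices; there are no arcs, so \<^const>\<open>fst\<close> and \<^const>\<open>snd\<close> are arbitrary.\<close>

definition isolated_vertices :: "nat \<Rightarrow> (nat, nat \<times> nat) pre_digraph" where
  "isolated_vertices k = \<lparr> verts = {..<k}, arcs = {}, tail = fst, head = snd \<rparr>"

definition sum_number :: "('a, 'b) pre_digraph \<Rightarrow> nat" where
  "sum_number H = (LEAST k. sum_graph (disjoint_union H (isolated_vertices k)))"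

end

theory Submission
  imports Defs "HOL-Library.Nat_Bijection"
begin

text \<open>
  Fix a vertex \<open>u\<close> and a sum labeling \<open>f\<close> of \<open>G\<^sub>u\<close> together with \<open>k\<close> isolated vertices.
  Sum labelings are positive, so giving \<open>u\<close> the label \<open>0\<close> keeps the labels of \<open>G\<close> distinct.
  Now every edge sum is one of the \<open>n - 1 + k\<close> values of \<open>f\<close>: an edge \<open>uv\<close> gets
  \<open>f v\<close> itself, and an edge inside \<open>G\<^sub>u\<close> gets the label of some vertex because \<open>f\<close> is a
  sum labeling. So the sum index is at most \<open>n - 1 + k\<close>
  (\<open>sum_index_le_of_sum_labeling\<close>).

  To take \<open>k\<close> to be the sum number of \<open>G\<^sub>u\<close>, one needs that the minimum defining it is attained,
  that is, that adding enough isolated vertices turns any finite simple graph into a sum graph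
  (\<open>sum_graph_with_isolated_vertices_exists\<close>). For this, label the vertices
  by \<open>M + 2\<^sup>i\<close> with distinct exponents \<open>i\<close> and a large \<open>M\<close>, and use the edge sums as the labels of the
  isolated vertices.
\<close>

lemma dominates_disjoint_union_simps:
  "Inl v \<rightarrow>\<^bsub>disjoint_union G H\<^esub> Inl w \<longleftrightarrow> v \<rightarrow>\<^bsub>G\<^esub> w"
  "\<not> Inl v \<rightarrow>\<^bsub>disjoint_union G H\<^esub> Inr y"
  "\<not> Inr x \<rightarrow>\<^bsub>disjoint_union G H\<^esub> Inl w"
  "Inr x \<rightarrow>\<^bsub>disjoint_union G H\<^esub> Inr y \<longleftrightarrow> x \<rightarrow>\<^bsub>H\<^esub> y"
  by (auto simp: disjoint_union_def arcs_ends_def arc_to_ends_def Plus_def image_iff bex_Un)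

lemma not_dominates_isolated_vertices: "\<not> x \<rightarrow>\<^bsub>isolated_vertices k\<^esub> y"
  by (simp add: isolated_vertices_def arcs_ends_def)

lemma finite_verts_disjoint_union_isolated:
  "finite (verts G) \<Longrightarrow> finite (verts (disjoint_union G (isolated_vertices k)))"
  by (simp add: disjoint_union_def isolated_vertices_def)

lemma card_verts_disjoint_union_isolated:
  "finite (verts G) \<Longrightarrow> card (verts (disjoint_union G (isolated_vertices k))) = card (verts G) + k"
  by (simp add: disjoint_union_def isolated_vertices_def card_Plus)

text \<open>Uniqueness of binary expansions makes the powers of two a Sidon set.\<close>

lemma sum_two_powers_inject:
  fixes i j k l :: nat
  assumes "i \<noteq> j" "k \<noteq> l" "2 ^ i + 2 ^ j = (2 ^ k + 2 ^ l :: nat)"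
  shows "{i, j} = {k, l}"
proof -
  have "set_encode {i, j} = set_encode {k, l}"
    using assms by (simp add: set_encode_def)
  then show ?thesis
    by (simp add: set_encode_eq)
qed

text \<open>
  The labels of the original vertices lie strictly between \<open>M\<close> and \<open>3/2 M\<close>, those of the isolated vertices
  strictly between \<open>2M\<close> and \<open>3M\<close>. So a sum of two labels can only be a label if both
  summands are original vertices and the result is an isolated one, i.e. an edge sum; by
  \<open>sum_two_powers_inject\<close> the edge is then the pair of summands itself.
\<close>

lemma sum_graph_with_isolated_vertices_exists:
  assumes "graph H"
  shows "\<exists>k. sum_graph (disjoint_union H (isolated_vertices k))"
proof -
  interpret graph H by fact
  obtain h where h: "bij_betw h (verts H) {0..<card (verts H)}"
    using ex_bij_betw_finite_nat[OF finite_verts] by blast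
  \<comment> \<open>The factor \<open>2\<close> keeps twice every power \<open>2 ^ h v\<close> below \<open>M\<close>, so that edge sums stay below \<open>3 * M\<close>.\<close>
  define M :: nat where "M = 2 * 2 ^ card (verts H)"
  define g where "g v = M + 2 ^ h v" for v
  define S where "S = {g v + g w | v w. v \<rightarrow>\<^bsub>H\<^esub> w}"
  have h_inj: "h v = h w \<longleftrightarrow> v = w" if "v \<in> verts H" "w \<in> verts H" for v w
    using h that by (auto simp: bij_betw_def inj_on_def)
  have "inj_on g (verts H)"
    by (auto simp: inj_on_def g_def h_inj)
  have g_bounds: "M < g v" "2 * g v < 3 * M" if "v \<in> verts H" for v
  proof -
    have "h v < card (verts H)"
      using bij_betwE[OF h] that by auto
    then have "(2::nat) ^ h v < 2 ^ card (verts H)"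
      by simp
    then show "2 * g v < 3 * M"
      unfolding g_def M_def by (simp add: algebra_simps)
  qed (simp add: g_def)
  have S_bounds: "2 * M < s" "s < 3 * M" if "s \<in> S" for s
  proof -
    obtain v w where s: "s = g v + g w" and "v \<rightarrow>\<^bsub>H\<^esub> w"
      using \<open>s \<in> S\<close> by (auto simp: S_def)
    then have "v \<in> verts H" "w \<in> verts H"
      by (auto dest: adj_in_verts)
    then show "2 * M < s" "s < 3 * M"
      using g_bounds[of v] g_bounds[of w] unfolding s by linarith+
  qed
  have "finite S"
    using S_bounds by (intro finite_subset[of S "{..<3 * M}"]) auto
  then obtain c where c: "bij_betw c {0..<card S} S"
    using ex_bij_betw_nat_finite by blast
  have edge_iff: "v \<rightarrow>\<^bsub>H\<^esub> w \<longleftrightarrow> g v + g w \<in> S"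
    if v: "v \<in> verts H" and w: "w \<in> verts H" and "v \<noteq> w" for v w
  proof
    assume "g v + g w \<in> S"
    then obtain v' w' where eq: "g v + g w = g v' + g w'" and adj: "v' \<rightarrow>\<^bsub>H\<^esub> w'"
      by (auto simp: S_def)
    have in_H: "v' \<in> verts H" "w' \<in> verts H"
      using adj by (auto dest: adj_in_verts)
    have "v' \<noteq> w'"
      using adj by (auto dest: adj_not_same)
    then have "{h v, h w} = {h v', h w'}"
      using eq \<open>v \<noteq> w\<close> by (intro sum_two_powers_inject) (auto simp: h_inj v w in_H g_def)
    then have "v = v' \<and> w = w' \<or> v = w' \<and> w = v'"
      by (simp add: doubleton_eq_iff h_inj v w in_H)
    then show "v \<rightarrow>\<^bsub>H\<^esub> w"
      using adj graph_symmetric[OF adj] by metis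
  qed (auto simp: S_def)
  have c_in: "c i \<in> S" if "i < card S" for i
    using bij_betwE[OF c] that by auto
  have c_ex: "\<exists>i<card S. s = c i" if "s \<in> S" for s
    using bij_betw_imp_surj_on[OF c] that by (metis atLeastLessThan_iff imageE)
  let ?U = "disjoint_union H (isolated_vertices (card S))"
  let ?f = "case_sum g c"
  have verts_U: "verts ?U = verts H <+> {..<card S}"
    by (simp add: disjoint_union_def isolated_vertices_def)
  have f_bounds: "M < ?f z" "?f z < 3 * M" if z: "z \<in> verts ?U" for z
  proof -
    have "M < ?f z \<and> ?f z < 3 * M"
    proof (cases z)
      case (Inl v)
      then have "v \<in> verts H"
        using z by (auto simp: verts_U)
      from g_bounds[OF this] show ?thesis
        using Inl by simp
    next
      case (Inr i)
      then have "c i \<in> S"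
        using z by (auto simp: verts_U intro: c_in)
      from S_bounds[OF this] show ?thesis
        using Inr by simp
    qed
    then show "M < ?f z" "?f z < 3 * M"
      by blast+
  qed
  have g_neq_c: "g v \<noteq> c i" if "v \<in> verts H" "i < card S" for v i
    using g_bounds(2)[OF that(1)] S_bounds(1)[OF c_in[OF that(2)]] by linarith
  have inj_c: "inj_on c {..<card S}"
    using c by (simp add: bij_betw_def atLeast0LessThan)
  have "sum_labeling ?U ?f"
    unfolding sum_labeling_def
  proof (intro conjI ballI impI)
    show "inj_on ?f (verts ?U)"
    proof (rule inj_onI)
      fix x y assume "x \<in> verts ?U" "y \<in> verts ?U" "?f x = ?f y"
      then show "x = y"
        using g_neq_c[THEN not_sym]
        by (cases x; cases y)
           (auto simp: verts_U g_neq_c inj_on_eq_iff[OF \<open>inj_on g (verts H)\<close>]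
             inj_on_eq_iff[OF inj_c])
    qed
    show "0 < ?f x" if "x \<in> verts ?U" for x
      using f_bounds(1)[OF that] by linarith
    show "x \<rightarrow>\<^bsub>?U\<^esub> y \<longleftrightarrow> (\<exists>z\<in>verts ?U. ?f x + ?f y = ?f z)"
      if x: "x \<in> verts ?U" and y: "y \<in> verts ?U" and "x \<noteq> y" for x y
    proof -
      \<comment> \<open>A sum with an isolated summand exceeds every label.\<close>
      have isolated: ?thesis if large: "2 * M < ?f x \<or> 2 * M < ?f y" and "\<not> x \<rightarrow>\<^bsub>?U\<^esub> y"
      proof -
        have "3 * M < ?f x + ?f y"
          using large f_bounds(1)[OF x] f_bounds(1)[OF y] by linarith
        then have "?f x + ?f y \<noteq> ?f z" if "z \<in> verts ?U" for z
          using f_bounds(2)[OF that] by linarith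
        then show ?thesis
          using \<open>\<not> x \<rightarrow>\<^bsub>?U\<^esub> y\<close> by blast
      qed
      show ?thesis
      proof (cases "\<exists>v w. x = Inl v \<and> y = Inl w")
        case True
        then obtain v w where xy: "x = Inl v" "y = Inl w"
          by blast
        have vw: "v \<in> verts H" "w \<in> verts H" "v \<noteq> w"
          using x y \<open>x \<noteq> y\<close> xy by (auto simp: verts_U)
        have "g v + g w \<noteq> g z" if "z \<in> verts H" for z
          using g_bounds[of v] g_bounds[of w] g_bounds[of z] vw that by linarith
        then have "(\<exists>z\<in>verts ?U. ?f x + ?f y = ?f z) \<longleftrightarrow> g v + g w \<in> S"
          by (auto simp: verts_U xy Plus_def bex_Un c_in dest: c_ex)
        then show ?thesis
          using edge_iff[OF vw] by (simp add: xy dominates_disjoint_union_simps)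
      next
        case False
        then consider i where "x = Inr i" | i where "y = Inr i"
          by (metis sum.exhaust)
        then have "2 * M < ?f x \<or> 2 * M < ?f y"
          using x y S_bounds c_in by cases (auto simp: verts_U)
        moreover have "\<not> x \<rightarrow>\<^bsub>?U\<^esub> y"
          using False
          by (cases x; cases y)
             (auto simp: dominates_disjoint_union_simps not_dominates_isolated_vertices)
        ultimately show ?thesis
          by (rule isolated)
      qed
    qed
  qed
  then show ?thesis
    unfolding sum_graph_def by blast
qed

text \<open>
  The sum index is a minimum over positive values; the value of a given labeling competes in it
  because there is an edge.
\<close>

lemma sum_index_le:
  assumes "graph G" "arcs G \<noteq> {}" "vertex_labeling G f"
  shows "sum_index G \<le> card (edge_labeling G f ` arcs G)"
proof -
  interpret graph G by fact
  have "0 < card (edge_labeling G f ` arcs G)"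
    using \<open>arcs G \<noteq> {}\<close> by (simp add: card_gt_0_iff)
  then show ?thesis
    unfolding sum_index_def using assms by (intro Least_le) blast
qed

lemma sum_index_le_of_sum_labeling:
  assumes "graph G" "arcs G \<noteq> {}" "u \<in> verts G"
    and "sum_labeling (disjoint_union (G \<restriction> (verts G - {u})) (isolated_vertices k)) f"
  shows "sum_index G \<le> card (verts G) - 1 + k"
proof -
  interpret graph G by fact
  let ?H = "G \<restriction> (verts G - {u})"
  let ?U = "disjoint_union ?H (isolated_vertices k)"
  define g :: "_ \<Rightarrow> int" where "g v = (if v = u then 0 else int (f (Inl v)))" for v
  have inj: "inj_on f (verts ?U)" and pos: "\<forall>x\<in>verts ?U. 0 < f x"
    and sum: "\<forall>x\<in>verts ?U. \<forall>y\<in>verts ?U. x \<noteq> y \<longrightarrow>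
      (x \<rightarrow>\<^bsub>?U\<^esub> y \<longleftrightarrow> (\<exists>z\<in>verts ?U. f x + f y = f z))"
    using assms(4) by (auto simp: sum_labeling_def)
  have in_U: "Inl v \<in> verts ?U" if "v \<in> verts G" "v \<noteq> u" for v
    using that by (auto simp: disjoint_union_def)
  have "vertex_labeling G g"
    unfolding vertex_labeling_def
  proof (rule inj_onI)
    fix v w assume "v \<in> verts G" "w \<in> verts G" "g v = g w"
    then show "v = w"
      using in_U[of v] in_U[of w] pos inj by (auto simp: g_def inj_on_def split: if_splits)
  qed
  moreover have "edge_labeling G g ` arcs G \<subseteq> (\<lambda>x. int (f x)) ` verts ?U"
  proof
    fix s assume "s \<in> edge_labeling G g ` arcs G"
    then obtain e where e: "e \<in> arcs G" and s: "s = g (tail G e) + g (head G e)"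
      by (auto simp: edge_labeling_def)
    let ?v = "tail G e" and ?w = "head G e"
    have ends: "?v \<in> verts G" "?w \<in> verts G" "?v \<noteq> ?w"
      using e no_loops by auto
    show "s \<in> (\<lambda>x. int (f x)) ` verts ?U"
    proof (cases "?v = u \<or> ?w = u")
      case True
      then show ?thesis
        using ends in_U by (auto simp: s g_def)
    next
      case False
      then have "?v \<rightarrow>\<^bsub>?H\<^esub> ?w"
        using e ends by (force simp: arcs_ends_def arc_to_ends_def)
      then have "Inl ?v \<rightarrow>\<^bsub>?U\<^esub> Inl ?w"
        by (simp add: dominates_disjoint_union_simps)
      then obtain z where "z \<in> verts ?U" "f (Inl ?v) + f (Inl ?w) = f z"
        using sum in_U ends False by blast
      then show ?thesis
        using False by (auto simp: s g_def simp flip: of_nat_add)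
    qed
  qed
  then have "card (edge_labeling G g ` arcs G) \<le> card (verts ?U)"
    by (intro surj_card_le finite_verts_disjoint_union_isolated) simp_all
  moreover have "card (verts ?U) = card (verts G) - 1 + k"
    using \<open>u \<in> verts G\<close> by (simp add: card_verts_disjoint_union_isolated)
  ultimately show ?thesis
    using sum_index_le[OF assms(1,2)] by fastforce
qed

theorem theorem2p4:
  fixes G :: "('a, 'b) pre_digraph"
  assumes "graph G"
    and "arcs G \<noteq> {}"
  shows "sum_index G \<le>
    (MIN u\<in>verts G. card (verts G) - 1 + sum_number (G \<restriction> (verts G - {u})))"
proof -
  interpret graph G by fact
  have "verts G \<noteq> {}"
    using assms(2) tail_in_verts by blast
  moreover have "sum_index G \<le> card (verts G) - 1 + sum_number (G \<restriction> (verts G - {u}))"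
    if "u \<in> verts G" for u
  proof -
    let ?H = "G \<restriction> (verts G - {u})"
    have "induced_subgraph ?H G"
      by (intro induced_induce) auto
    then have "graph ?H"
      using digraphI_induced induced_graph_imp_graph
      by (simp add: graph_def pseudo_graph_def digraph_def)
    then have "sum_graph (disjoint_union ?H (isolated_vertices (sum_number ?H)))"
      unfolding sum_number_def by (rule LeastI_ex[OF sum_graph_with_isolated_vertices_exists])
    then show ?thesis
      unfolding sum_graph_def using sum_index_le_of_sum_labeling[OF assms that] by blast
  qed
  ultimately show ?thesis
    by simp
qed

end
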